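(* Let $(a_n)_{n\ge1}$ and $(b_n)_{n\ge1}$ be sequences of positive integers and let $\tau$ be the value of the generalized continued fraction \[ \tau=\cfrac{a_1}{b_1+\cfrac{a_2}{b_2+\cdots}}. \] Suppose \[ \alpha_1\le a_n\le\alpha_2,\qquad \beta_1\le b_n\le\beta_2 \] for all $n\in\mathbb{Z}^+$, where $\alpha_1,\alpha_2,\beta_1,\beta_2$ are positive integers satisfying \[ \gamma_1:=\frac{\beta_1+\sqrt{\beta_1^2+4\alpha_1}}{2}>\alpha_2 . \] Then $\tau$ is irrational and \[ \mu_I(\tau)\le 2+\frac{\log\alpha_2}{\log\gamma_1-\log\alpha_2}. \]
   Context: The value of the generalized continued fraction is the limit $\lim_{n\to\infty}A_n/B_n$ of its convergents, where $A_0=0$, $B_0=1$, $A_1=a_1$, $B_1=b_1$ and $A_{n+2}=b_{n+2}A_{n+1}+a_{n+2}A_n$, $B_{n+2}=b_{n+2}B_{n+1}+a_{n+2}B_n$ for $n\ge 0$ (such a limit need not exist in general, but it does in all instances considered here). For a real number $\tau$, an irrationality exponent of $\tau$ is any $\mu$ for which there exist positive constants $c$ and $N_0$ such that $\left|\tau-\frac{M}{N}\right|\ge \frac{c}{N^{\mu}}$ for all $M,N\in\mathbb{Z}$ with $N\ge N_0$. The asymptotic irrationality exponent $\mu_I(\tau)$ is the infimum of all irrationality exponents $\mu$ of $\tau$, where the infimum of the empty set is $\infty$. *)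

theory Defs
  imports "HOL-Analysis.Analysis"
begin

(* The partial numerators and denominators are indexed from 1: a 0 and b 0 are never used. *)

fun gcf_num :: "(nat \<Rightarrow> nat) \<Rightarrow> (nat \<Rightarrow> nat) \<Rightarrow> nat \<Rightarrow> nat" where
  "gcf_num a b 0 = 0"
| "gcf_num a b (Suc 0) = a 1"
| "gcf_num a b (Suc (Suc n)) = b (n + 2) * gcf_num a b (Suc n) + a (n + 2) * gcf_num a b n"

fun gcf_denom :: "(nat \<Rightarrow> nat) \<Rightarrow> (nat \<Rightarrow> nat) \<Rightarrow> nat \<Rightarrow> nat" where
  "gcf_denom a b 0 = 1"
| "gcf_denom a b (Suc 0) = b 1"
| "gcf_denom a b (Suc (Suc n)) = b (n + 2) * gcf_denom a b (Suc n) + a (n + 2) * gcf_denom a b n"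

definition gcf_convergent :: "(nat \<Rightarrow> nat) \<Rightarrow> (nat \<Rightarrow> nat) \<Rightarrow> nat \<Rightarrow> real" where
  "gcf_convergent a b n = real (gcf_num a b n) / real (gcf_denom a b n)"

(* Only meaningful if the sequence of convergents is convergent. *)
definition gcf_value :: "(nat \<Rightarrow> nat) \<Rightarrow> (nat \<Rightarrow> nat) \<Rightarrow> real" where
  "gcf_value a b = lim (gcf_convergent a b)"

definition irrationality_exponent :: "real \<Rightarrow> real \<Rightarrow> bool" where
  "irrationality_exponent \<tau> \<mu> \<longleftrightarrow>
     (\<exists>c N\<^sub>0 :: real. c > 0 \<and> N\<^sub>0 > 0 \<and>
        (\<forall>M N :: int. real_of_int N \<ge> N\<^sub>0 \<longrightarrow>
           \<bar>\<tau> - real_of_int M / real_of_int N\<bar> \<ge> c / real_of_int N powr \<mu>))"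

(* Taken in the extended reals, where the infimum of the empty set is \<infinity>. *)
definition asymp_irrationality_exponent :: "real \<Rightarrow> ereal" where
  "asymp_irrationality_exponent \<tau> = (INF \<mu> \<in> {\<mu>. irrationality_exponent \<tau> \<mu>}. ereal \<mu>)"

end

theory Submission
  imports Defs
begin

text \<open>
  Write \<open>A\<^sub>n / B\<^sub>n\<close> for the convergents and \<open>P\<^sub>n = a\<^sub>1 \<cdots> a\<^sub>n\<close>. The determinant identity
  \<open>A\<^sub>n\<^sub>+\<^sub>1 B\<^sub>n - A\<^sub>n B\<^sub>n\<^sub>+\<^sub>1 = (-1)\<^sup>n P\<^sub>n\<^sub>+\<^sub>1\<close> does two jobs. It makes the convergents the partial sums of an
  alternating series with decreasing terms, so that the Leibniz estimate gives
  \<open>\<bar>B\<^sub>n \<tau> - A\<^sub>n\<bar> \<le> P\<^sub>n\<^sub>+\<^sub>1 / B\<^sub>n\<^sub>+\<^sub>1\<close> (lemma \<open>convergent_error\<close>), and it shows that consecutive convergents are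
  distinct, so that a given fraction \<open>M / N\<close> differs from at least one of any two neighbours.

  If \<open>M / N \<noteq> A\<^sub>k / B\<^sub>k\<close>, then \<open>M B\<^sub>k - N A\<^sub>k\<close> is a nonzero integer. Once \<open>\<bar>B\<^sub>k \<tau> - A\<^sub>k\<bar> < 1 / (2 N)\<close>, this
  forces \<open>\<bar>\<tau> - M / N\<bar> \<ge> 1 / (2 N B\<^sub>k)\<close> (lemma \<open>rational_distance\<close>), so everything depends on finding an
  admissible \<open>k\<close> with \<open>B\<^sub>k\<close> small.

  The denominators grow at least like \<open>\<gamma>\<^sub>1\<^sup>n\<close>, since \<open>\<gamma>\<^sub>1\<close> is the positive root of \<open>x\<^sup>2 = \<beta>\<^sub>1 x + \<alpha>\<^sub>1\<close>; hence
  \<open>P\<^sub>n / B\<^sub>n\<close> is at most a constant times \<open>(\<alpha>\<^sub>2 / \<gamma>\<^sub>1)\<^sup>n\<close> and tends to 0. They may grow much faster, however, so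
  the index must be chosen by the size of \<open>P\<^sub>n / B\<^sub>n\<close> itself rather than by that of its geometric bound: take the
  last \<open>n\<close> with \<open>P\<^sub>n / B\<^sub>n \<ge> 1 / (2 N)\<close>. Then \<open>n\<close> and \<open>n + 1\<close> are both admissible, and the choice of \<open>n\<close> also
  bounds the denominator from above, \<open>B\<^sub>n \<le> 2 N P\<^sub>n \<le> 2 N \<alpha>\<^sub>2\<^sup>n\<close>. Finally \<open>(\<gamma>\<^sub>1 / \<alpha>\<^sub>2)\<^sup>n\<close> is at most a multiple
  of \<open>N\<close>, and raising this to the power \<open>\<delta> = ln \<alpha>\<^sub>2 / (ln \<gamma>\<^sub>1 - ln \<alpha>\<^sub>2)\<close> turns it into a bound for
  \<open>\<alpha>\<^sub>2\<^sup>n\<close> by a multiple of \<open>N\<^sup>\<delta>\<close>. Thus \<open>B\<^sub>k\<close> is at most a multiple of \<open>N\<^sup>1\<^sup>+\<^sup>\<delta>\<close>, and \<open>2 + \<delta>\<close> is an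
  irrationality exponent. Irrationality comes for free, because a rational number has no irrationality exponent.
\<close>

section \<open>General facts on irrationality exponents and alternating series\<close>

text \<open>
  A rational number equals fractions with arbitrarily large denominators, obtained by expanding a representation,
  and these violate every lower bound for the distance.
\<close>

lemma irrationality_exponent_imp_irrational:
  assumes "irrationality_exponent \<tau> \<mu>"
  shows "\<tau> \<notin> \<rat>"
proof
  assume "\<tau> \<in> \<rat>"
  then obtain p q :: int where q: "q > 0" and \<tau>: "\<tau> = of_int p / of_int q"
    by (metis Rats_cases' of_int_0_less_iff)
  from assms obtain c N0 :: real where c: "c > 0" and N0: "N0 > 0"
    and bound: "\<And>M N :: int. real_of_int N \<ge> N0 \<Longrightarrow>
      \<bar>\<tau> - of_int M / of_int N\<bar> \<ge> c / of_int N powr \<mu>"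
    unfolding irrationality_exponent_def by blast
  define m :: int where "m = \<lceil>N0\<rceil>"
  have m: "m > 0" "real_of_int m \<ge> N0"
    using N0 by (auto simp: m_def)
  have "m * 1 \<le> m * q"
    using q m(1) by (intro mult_left_mono) auto
  hence "real_of_int m \<le> real_of_int (m * q)"
    by linarith
  hence large: "real_of_int (m * q) \<ge> N0"
    using m(2) by linarith
  have "\<tau> = of_int (m * p) / of_int (m * q)"
    using m(1) by (simp add: \<tau>)
  with bound[OF large, of "m * p"] have "c / of_int (m * q) powr \<mu> \<le> 0"
    by simp
  moreover have "c / of_int (m * q) powr \<mu> > 0"
    using c m(1) q by (intro divide_pos_pos) auto
  ultimately show False
    by linarith
qed

lemma alternating_series_error:
  fixes f :: "nat \<Rightarrow> real"
  assumes lim: "f \<longlonglongrightarrow> 0" and nonneg: "\<And>n. f n \<ge> 0" and decr: "\<And>n. f (Suc n) \<le> f n"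
  shows "\<bar>(\<Sum>i. (-1) ^ i * f i) - (\<Sum>i<n. (-1) ^ i * f i)\<bar> \<le> f n"
proof -
  define S where "S = (\<Sum>i. (-1) ^ i * f i)"
  define s where "s = (\<lambda>n. \<Sum>i<n. (-1) ^ i * f i)"
  have lower: "s (2 * m) \<le> S" and upper: "S \<le> s (2 * m + 1)" for m
    unfolding s_def S_def
    using summable_Leibniz'(2,4)[OF lim nonneg decr] by blast+
  show ?thesis
  proof (cases "even n")
    case True
    then obtain m where "n = 2 * m" ..
    then show ?thesis
      using lower[of m] upper[of m] by (simp add: s_def flip: S_def)
  next
    case False
    then obtain m where "n = 2 * m + 1" ..
    then show ?thesis
      using lower[of "Suc m"] upper[of m] by (simp add: s_def flip: S_def)
  qed
qed

section \<open>Generalized continued fractions with positive entries\<close>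

locale positive_gcf =
  fixes a b :: "nat \<Rightarrow> nat"
  assumes a_pos: "n \<ge> 1 \<Longrightarrow> a n > 0"
    and b_pos: "n \<ge> 1 \<Longrightarrow> b n > 0"
begin

abbreviation A :: "nat \<Rightarrow> nat" where "A \<equiv> gcf_num a b"

abbreviation B :: "nat \<Rightarrow> nat" where "B \<equiv> gcf_denom a b"

definition P :: "nat \<Rightarrow> nat" where "P n = (\<Prod>i=1..n. a i)"

lemma P_0 [simp]: "P 0 = 1"
  and P_Suc: "P (Suc n) = P n * a (Suc n)"
  by (simp_all add: P_def)

lemma P_pos: "P n > 0"
  using a_pos by (auto simp: P_def intro!: prod_pos)

lemma B_pos: "B n > 0"
proof (induction n rule: induct_nat_012)
  case (ge2 n)
  then show ?case
    using b_pos[of "n + 2"] by simp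
qed (use b_pos[of 1] in auto)

lemma B_Suc_ge: "B n \<le> B (Suc n)"
proof (cases n)
  case 0
  then show ?thesis
    using b_pos[of 1] by simp
next
  case (Suc m)
  have "1 * B (Suc m) \<le> b (m + 2) * B (Suc m)"
    using b_pos[of "m + 2"] by (intro mult_right_mono) auto
  then show ?thesis
    by (simp add: Suc trans_le_add1 del: mult_le_cancel2)
qed

lemma B_Suc_le:
  assumes "\<And>n. n \<ge> 1 \<Longrightarrow> a n \<le> p" and "\<And>n. n \<ge> 1 \<Longrightarrow> b n \<le> q"
  shows "B (Suc n) \<le> (q + p) * B n"
proof (cases n)
  case 0
  then show ?thesis
    using assms(2)[of 1] by simp
next
  case (Suc m)
  have "b (m + 2) * B (Suc m) + a (m + 2) * B m \<le> q * B (Suc m) + p * B (Suc m)"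
    using assms[of "m + 2"] B_Suc_ge[of m] by (intro add_mono mult_mono) auto
  then show ?thesis
    by (simp add: Suc algebra_simps)
qed

lemma convergents_determinant:
  "int (A (Suc n)) * int (B n) - int (A n) * int (B (Suc n)) = (-1) ^ n * int (P (Suc n))"
proof (induction n)
  case 0
  then show ?case
    by (simp add: P_Suc)
next
  case (Suc n)
  have "int (A (Suc (Suc n))) * int (B (Suc n)) - int (A (Suc n)) * int (B (Suc (Suc n)))
      = - int (a (n + 2)) * (int (A (Suc n)) * int (B n) - int (A n) * int (B (Suc n)))"
    by (simp add: algebra_simps)
  also have "\<dots> = (-1) ^ Suc n * int (P (Suc (Suc n)))"
    unfolding Suc.IH by (simp add: P_Suc)
  finally show ?case .
qed

definition gap :: "nat \<Rightarrow> real" where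
  "gap n = real (P (Suc n)) / (real (B n) * real (B (Suc n)))"

lemma gap_nonneg: "gap n \<ge> 0"
  by (simp add: gap_def)

text \<open>
  The quotient of consecutive gaps is \<open>a\<^sub>n\<^sub>+\<^sub>2 B\<^sub>n / B\<^sub>n\<^sub>+\<^sub>2\<close>, whose numerator is one of the two summands in the
  recurrence for its denominator.
\<close>

lemma gap_Suc_le: "gap (Suc n) \<le> gap n"
proof -
  have "a (n + 2) * B n \<le> B (Suc (Suc n))"
    by simp
  hence le: "real (a (n + 2)) * real (B n) \<le> real (B (Suc (Suc n)))"
    by (metis of_nat_le_iff of_nat_mult)
  have pos: "real (B n) > 0" "real (B (Suc n)) > 0" "real (B (Suc (Suc n))) > 0"
    using B_pos by (simp_all del: gcf_denom.simps)
  have "gap (Suc n) = gap n * (real (a (n + 2)) * real (B n) / real (B (Suc (Suc n))))"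
    using pos by (simp add: gap_def P_Suc[of "Suc n"] field_simps del: gcf_denom.simps)
  also have "\<dots> \<le> gap n * 1"
    using le pos gap_nonneg by (intro mult_left_mono) (auto simp del: gcf_denom.simps)
  finally show ?thesis
    by simp
qed

lemma convergent_as_alternating_sum: "gcf_convergent a b n = (\<Sum>i<n. (-1) ^ i * gap i)"
proof (induction n)
  case 0
  then show ?case
    by (simp add: gcf_convergent_def)
next
  case (Suc n)
  have pos: "real (B n) > 0" "real (B (Suc n)) > 0"
    using B_pos by (simp_all del: gcf_denom.simps)
  have "real_of_int (int (A (Suc n)) * int (B n) - int (A n) * int (B (Suc n)))
      = real_of_int ((-1) ^ n * int (P (Suc n)))"
    by (simp only: convergents_determinant)
  hence "real (A (Suc n)) * real (B n) - real (A n) * real (B (Suc n)) = (-1) ^ n * real (P (Suc n))"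
    by (simp del: gcf_num.simps gcf_denom.simps)
  hence "gcf_convergent a b (Suc n) - gcf_convergent a b n = (-1) ^ n * gap n"
    using pos
    by (simp add: gcf_convergent_def gap_def diff_frac_eq mult.commute del: gcf_num.simps gcf_denom.simps)
  with Suc.IH show ?case
    by simp
qed

lemma gap_le_quotient: "gap n \<le> real (P (Suc n)) / real (B (Suc n))"
proof -
  have "1 * real (B (Suc n)) \<le> real (B n) * real (B (Suc n))"
    using B_pos[of n] by (intro mult_right_mono) auto
  then show ?thesis
    unfolding gap_def using B_pos[of n] B_pos[of "Suc n"]
    by (intro divide_left_mono) (auto simp del: gcf_denom.simps)
qed

text \<open>
  Decay of \<open>P\<^sub>n / B\<^sub>n\<close>, rather than merely of the gaps, is the hypothesis under which the integer relations
  \<open>B\<^sub>n \<tau> - A\<^sub>n\<close> become small; it also makes the continued fraction converge.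
\<close>

lemma
  assumes lim: "(\<lambda>n. real (P n) / real (B n)) \<longlonglongrightarrow> 0"
  shows gcf_convergent_converges: "convergent (gcf_convergent a b)"
    and convergent_error: "\<bar>real (B n) * gcf_value a b - real (A n)\<bar> \<le> real (P (Suc n)) / real (B (Suc n))"
proof -
  have gap_lim: "gap \<longlonglongrightarrow> 0"
    by (rule tendsto_sandwich[OF _ _ tendsto_const LIMSEQ_Suc[OF lim]])
      (auto intro!: always_eventually gap_nonneg gap_le_quotient)
  have "gcf_convergent a b \<longlonglongrightarrow> (\<Sum>i. (-1) ^ i * gap i)"
    unfolding convergent_as_alternating_sum[abs_def]
    by (intro summable_LIMSEQ summable_Leibniz'(1)[OF gap_lim gap_nonneg gap_Suc_le])
  then have conv: "convergent (gcf_convergent a b)" and series: "gcf_value a b = (\<Sum>i. (-1) ^ i * gap i)"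
    by (auto simp: gcf_value_def convergent_def dest: limI)
  show "convergent (gcf_convergent a b)"
    by (rule conv)
  have err: "\<bar>gcf_value a b - gcf_convergent a b n\<bar> \<le> gap n"
    unfolding series convergent_as_alternating_sum
    by (rule alternating_series_error[OF gap_lim gap_nonneg gap_Suc_le])
  have pos: "real (B n) > 0"
    using B_pos by simp
  have "real (B n) * gcf_value a b - real (A n) = real (B n) * (gcf_value a b - gcf_convergent a b n)"
    using pos by (simp add: gcf_convergent_def field_simps)
  hence "\<bar>real (B n) * gcf_value a b - real (A n)\<bar> = real (B n) * \<bar>gcf_value a b - gcf_convergent a b n\<bar>"
    by (simp add: abs_mult)
  also have "\<dots> \<le> real (B n) * gap n"
    using err by (intro mult_left_mono) auto
  also have "\<dots> = real (P (Suc n)) / real (B (Suc n))"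
    using pos by (simp add: gap_def del: gcf_denom.simps)
  finally show "\<bar>real (B n) * gcf_value a b - real (A n)\<bar> \<le> real (P (Suc n)) / real (B (Suc n))" .
qed

lemma fraction_misses_neighbouring_convergent:
  assumes "N \<noteq> 0"
  obtains k where "k = n \<or> k = Suc n" and "M * int (B k) \<noteq> N * int (A k)"
proof (cases "M * int (B n) = N * int (A n) \<and> M * int (B (Suc n)) = N * int (A (Suc n))")
  case True
  have "N * ((-1) ^ n * int (P (Suc n)))
      = N * int (A (Suc n)) * int (B n) - N * int (A n) * int (B (Suc n))"
    by (simp add: algebra_simps flip: convergents_determinant del: gcf_num.simps gcf_denom.simps)
  also have "\<dots> = M * int (B (Suc n)) * int (B n) - M * int (B n) * int (B (Suc n))"
    using True by metis
  also have "\<dots> = 0"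
    by simp
  finally show ?thesis
    using assms P_pos[of "Suc n"] by simp
next
  case False
  then show ?thesis
    using that by blast
qed

text \<open>
  For the convergent that differs from \<open>M / N\<close>, the nonzero integer \<open>M B\<^sub>k - N A\<^sub>k\<close> splits as
  \<open>N (B\<^sub>k \<tau> - A\<^sub>k) - B\<^sub>k (N \<tau> - M)\<close>. The first part contributes at most one half, so the second must contribute
  the rest.
\<close>

lemma rational_distance:
  fixes M N :: int
  assumes lim: "(\<lambda>n. real (P n) / real (B n)) \<longlonglongrightarrow> 0"
    and N: "N > 0"
    and small: "\<And>m. m > n \<Longrightarrow> real (P m) / real (B m) < 1 / (2 * real_of_int N)"
  obtains k where "k = n \<or> k = Suc n"
    and "\<bar>gcf_value a b - of_int M / of_int N\<bar> \<ge> 1 / (2 * of_int N * real (B k))"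
proof -
  define \<tau> where "\<tau> = gcf_value a b"
  obtain k where k: "k = n \<or> k = Suc n" and ne: "M * int (B k) \<noteq> N * int (A k)"
    using fraction_misses_neighbouring_convergent[of N n M] N by auto
  have Npos: "real_of_int N > 0"
    using N by simp
  have Bpos: "real (B k) > 0"
    using B_pos by simp
  have "\<bar>real (B k) * \<tau> - real (A k)\<bar> < 1 / (2 * of_int N)"
    using convergent_error[OF lim, of k] small[of "Suc k"] k unfolding \<tau>_def by linarith
  hence "of_int N * \<bar>real (B k) * \<tau> - real (A k)\<bar> < of_int N * (1 / (2 * of_int N))"
    using Npos by (rule mult_strict_left_mono)
  hence first: "\<bar>of_int N * (real (B k) * \<tau> - real (A k))\<bar> < 1 / 2"
    using Npos by (simp add: abs_mult)
  have "1 \<le> \<bar>M * int (B k) - N * int (A k)\<bar>"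
    using ne by linarith
  hence "1 \<le> \<bar>real_of_int (M * int (B k) - N * int (A k))\<bar>"
    by linarith
  also have "real_of_int (M * int (B k) - N * int (A k))
      = of_int N * (real (B k) * \<tau> - real (A k)) - of_int N * real (B k) * (\<tau> - of_int M / of_int N)"
    using Npos by (simp add: field_simps)
  finally have "1 / 2 \<le> \<bar>of_int N * real (B k) * (\<tau> - of_int M / of_int N)\<bar>"
    using first by linarith
  also have "\<dots> = of_int N * real (B k) * \<bar>\<tau> - of_int M / of_int N\<bar>"
    using Npos by (simp add: abs_mult)
  finally have "1 / (2 * of_int N * real (B k)) \<le> \<bar>\<tau> - of_int M / of_int N\<bar>"
    using Npos Bpos by (simp add: field_simps)
  with k show ?thesis
    using that unfolding \<tau>_def by blast
qed

section \<open>From geometric decay to an irrationality exponent\<close>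

text \<open>
  The constant \<open>p / g\<close> compensates for the first step, where \<open>B\<^sub>1\<close> need only reach \<open>p\<close> while \<open>g \<ge> p\<close>.
\<close>

lemma B_lower_bound:
  fixes p q g :: real
  assumes "\<And>n. n \<ge> 1 \<Longrightarrow> q \<le> real (a n)" and "\<And>n. n \<ge> 1 \<Longrightarrow> p \<le> real (b n)"
    and nonneg: "p \<ge> 0" "q \<ge> 0" and g: "g > 0" "g\<^sup>2 = p * g + q"
  shows "p / g * g ^ n \<le> real (B n)"
proof (induction n rule: induct_nat_012)
  case 0
  have "p * g \<le> g * g"
    using g nonneg by (simp add: power2_eq_square)
  then show ?case
    using g by simp
next
  case 1
  then show ?case
    using assms(2)[of 1] g by simp
next
  case (ge2 n)
  have "p / g * g ^ Suc (Suc n) = p / g * g ^ n * g\<^sup>2"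
    by (simp add: power2_eq_square)
  also have "\<dots> = p * (p / g * g ^ Suc n) + q * (p / g * g ^ n)"
    unfolding g(2) using g(1) by (simp add: field_simps)
  also have "\<dots> \<le> real (b (n + 2)) * real (B (Suc n)) + real (a (n + 2)) * real (B n)"
    using ge2 assms(1)[of "n + 2"] assms(2)[of "n + 2"] nonneg g
    by (intro add_mono mult_mono) auto
  finally show ?case
    by simp
qed

lemma quotient_tendsto_zero_of_geometric_decay:
  fixes K r :: real
  assumes r: "r > 1" and decay: "\<And>n. real (P n) / real (B n) \<le> K / r ^ n"
  shows "(\<lambda>n. real (P n) / real (B n)) \<longlonglongrightarrow> 0"
  by (rule tendsto_sandwich[OF _ _ tendsto_const LIMSEQ_divide_realpow_zero[OF r, of K]])
    (auto intro!: always_eventually decay)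

text \<open>
  The ratio \<open>r\<close> controls how large the index of the critical convergent can be in terms of \<open>N\<close>, and \<open>\<delta>\<close> is
  the exponent that converts a bound for \<open>r\<^sup>n\<close> into one for \<open>P\<^sub>n\<close>.
\<close>

lemma irrationality_exponent_of_geometric_decay:
  fixes K r \<delta> :: real and s L :: nat
  assumes P_le: "\<And>n. P n \<le> s ^ n"
    and B_le: "\<And>n. B (Suc n) \<le> L * B n" and L: "L \<ge> 1"
    and decay: "\<And>n. real (P n) / real (B n) \<le> K / r ^ n"
    and K: "K > 0" and r: "r > 1" and \<delta>: "\<delta> \<ge> 0" "r powr \<delta> = real s"
  shows "irrationality_exponent (gcf_value a b) (2 + \<delta>)"
proof -
  have lim: "(\<lambda>n. real (P n) / real (B n)) \<longlonglongrightarrow> 0"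
    by (rule quotient_tendsto_zero_of_geometric_decay[OF r decay])
  define c where "c = 1 / (4 * real L * (2 * K) powr \<delta>)"
  have "c / of_int N powr (2 + \<delta>) \<le> \<bar>gcf_value a b - of_int M / of_int N\<bar>"
    if "real_of_int N \<ge> 1" for M N :: int
  proof -
    define x where "x = real_of_int N"
    have x: "x \<ge> 1"
      using that by (simp add: x_def)
    have N: "N > 0"
      using that by linarith
    \<comment> \<open>The set of critical indices contains 0, where the quotient is 1, and is finite because the quotients tend to 0.\<close>
    define I where "I = {n. real (P n) / real (B n) \<ge> 1 / (2 * x)}"
    have "eventually (\<lambda>n. real (P n) / real (B n) < 1 / (2 * x)) sequentially"
      using lim x by (intro order_tendstoD) auto
    hence fin: "finite I"
      by (simp add: I_def eventually_cofinite not_less flip: cofinite_eq_sequentially)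
    have "0 \<in> I"
      using x by (simp add: I_def)
    define n where "n = Max I"
    have "n \<in> I"
      using fin \<open>0 \<in> I\<close> unfolding n_def by (intro Max_in) auto
    hence crit: "1 / (2 * x) \<le> real (P n) / real (B n)"
      by (simp add: I_def)
    have "m \<notin> I" if "m > n" for m
      using that Max_ge[OF fin, of m] unfolding n_def by auto
    hence small: "real (P m) / real (B m) < 1 / (2 * real_of_int N)" if "m > n" for m
      using that by (auto simp: I_def x_def not_le)
    obtain k where k: "k = n \<or> k = Suc n"
      and dist: "1 / (2 * x * real (B k)) \<le> \<bar>gcf_value a b - of_int M / of_int N\<bar>"
      using rational_distance[OF lim N small, where M = M] unfolding x_def by metis
    have "1 / (2 * x) \<le> K / r ^ n"
      using crit decay[of n] by linarith
    hence "r ^ n \<le> 2 * K * x"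
      using x r by (simp add: field_simps)
    hence "(r ^ n) powr \<delta> \<le> (2 * K * x) powr \<delta>"
      using \<delta>(1) r by (intro powr_mono2) auto
    moreover have "(r ^ n) powr \<delta> = real s ^ n"
      using r by (simp add: powr_powr mult.commute flip: \<delta>(2) powr_realpow)
    ultimately have s_le: "real s ^ n \<le> (2 * K) powr \<delta> * x powr \<delta>"
      using K x by (simp add: powr_mult)
    have Ppow: "real (P n) \<le> real s ^ n"
      using P_le[of n] by (metis of_nat_le_iff of_nat_power)
    have "B k \<le> L * B n"
      using k B_le[of n] L by auto
    hence "real (B k) \<le> real L * real (B n)"
      by (metis of_nat_le_iff of_nat_mult)
    also have "real (B n) \<le> 2 * x * real (P n)"
      using crit x B_pos[of n] by (simp add: field_simps)
    also have "real (P n) \<le> (2 * K) powr \<delta> * x powr \<delta>"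
      using Ppow s_le by linarith
    finally have "real (B k) \<le> real L * (2 * x * ((2 * K) powr \<delta> * x powr \<delta>))"
      using x by (simp add: mult_left_mono)
    hence "2 * x * real (B k) \<le> 2 * x * (real L * (2 * x * ((2 * K) powr \<delta> * x powr \<delta>)))"
      using x by (intro mult_left_mono) auto
    also have "\<dots> = x powr (2 + \<delta>) / c"
      using x by (simp add: c_def powr_add power2_eq_square)
    finally have "1 / (x powr (2 + \<delta>) / c) \<le> 1 / (2 * x * real (B k))"
      using x B_pos[of k] by (intro divide_left_mono mult_pos_pos) (use L K in \<open>auto simp: c_def\<close>)
    with dist show ?thesis
      by (simp add: x_def)
  qed
  moreover have "c > 0"
    using K L by (simp add: c_def)
  ultimately show ?thesis
    unfolding irrationality_exponent_def by (intro exI[of _ c] exI[of _ 1]) auto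
qed

end

section \<open>Entries in bounded ranges\<close>

theorem theorem3p1:
  fixes a b :: "nat \<Rightarrow> nat"
    and \<alpha>\<^sub>1 \<alpha>\<^sub>2 \<beta>\<^sub>1 \<beta>\<^sub>2 :: nat
    and \<gamma>\<^sub>1 \<tau> :: real
  assumes "\<And>n. n \<ge> 1 \<Longrightarrow> a n > 0"
    and "\<And>n. n \<ge> 1 \<Longrightarrow> b n > 0"
    and "\<alpha>\<^sub>1 > 0" "\<alpha>\<^sub>2 > 0" "\<beta>\<^sub>1 > 0" "\<beta>\<^sub>2 > 0"
    and "\<And>n. n \<ge> 1 \<Longrightarrow> \<alpha>\<^sub>1 \<le> a n \<and> a n \<le> \<alpha>\<^sub>2"
    and "\<And>n. n \<ge> 1 \<Longrightarrow> \<beta>\<^sub>1 \<le> b n \<and> b n \<le> \<beta>\<^sub>2"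
    and "\<gamma>\<^sub>1 = (real \<beta>\<^sub>1 + sqrt ((real \<beta>\<^sub>1)\<^sup>2 + 4 * real \<alpha>\<^sub>1)) / 2"
    and "\<gamma>\<^sub>1 > real \<alpha>\<^sub>2"
    and "\<tau> = gcf_value a b"
  shows "convergent (gcf_convergent a b) \<and> \<tau> \<notin> \<rat> \<and>
    asymp_irrationality_exponent \<tau>
      \<le> ereal (2 + ln (real \<alpha>\<^sub>2) / (ln \<gamma>\<^sub>1 - ln (real \<alpha>\<^sub>2)))"
proof -
  interpret positive_gcf a b
    using assms(1,2) by unfold_locales auto
  define \<delta> where "\<delta> = ln (real \<alpha>\<^sub>2) / (ln \<gamma>\<^sub>1 - ln (real \<alpha>\<^sub>2))"
  define K where "K = \<gamma>\<^sub>1 / real \<beta>\<^sub>1"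
  have \<gamma>: "\<gamma>\<^sub>1 > 0"
    using assms(10) by linarith
  have K: "K > 0"
    using \<gamma> assms(5) by (simp add: K_def)
  have root: "\<gamma>\<^sub>1\<^sup>2 = real \<beta>\<^sub>1 * \<gamma>\<^sub>1 + real \<alpha>\<^sub>1"
  proof -
    have "2 * \<gamma>\<^sub>1 - real \<beta>\<^sub>1 = sqrt ((real \<beta>\<^sub>1)\<^sup>2 + 4 * real \<alpha>\<^sub>1)"
      using assms(9) by (simp add: field_simps)
    hence "(2 * \<gamma>\<^sub>1 - real \<beta>\<^sub>1)\<^sup>2 = (real \<beta>\<^sub>1)\<^sup>2 + 4 * real \<alpha>\<^sub>1"
      by simp
    then show ?thesis
      by (simp add: power2_eq_square algebra_simps)
  qed
  have B_ge: "real \<beta>\<^sub>1 / \<gamma>\<^sub>1 * \<gamma>\<^sub>1 ^ n \<le> real (B n)" for n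
    by (rule B_lower_bound[OF _ _ _ _ \<gamma> root]) (use assms(7,8) in auto)
  have P_le: "P n \<le> \<alpha>\<^sub>2 ^ n" for n
    unfolding P_def using prod_mono[of "{1..n}" a "\<lambda>_. \<alpha>\<^sub>2"] assms(7) by simp
  have decay: "real (P n) / real (B n) \<le> K / (\<gamma>\<^sub>1 / real \<alpha>\<^sub>2) ^ n" for n
  proof -
    have "real (P n) \<le> real \<alpha>\<^sub>2 ^ n"
      using P_le[of n] by (metis of_nat_le_iff of_nat_power)
    hence "real (P n) / real (B n) \<le> real \<alpha>\<^sub>2 ^ n / (real \<beta>\<^sub>1 / \<gamma>\<^sub>1 * \<gamma>\<^sub>1 ^ n)"
      using B_ge[of n] \<gamma> assms(5) by (intro frac_le) auto
    also have "\<dots> = K / (\<gamma>\<^sub>1 / real \<alpha>\<^sub>2) ^ n"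
      by (simp add: K_def power_divide)
    finally show ?thesis .
  qed
  have ratio: "\<gamma>\<^sub>1 / real \<alpha>\<^sub>2 > 1"
    using assms(4,10) by simp
  have ln_less: "ln (real \<alpha>\<^sub>2) < ln \<gamma>\<^sub>1"
    using assms(4,10) \<gamma> by simp
  have \<delta>_nonneg: "\<delta> \<ge> 0"
    using assms(4) ln_less by (simp add: \<delta>_def)
  have "\<delta> * ln (\<gamma>\<^sub>1 / real \<alpha>\<^sub>2) = ln (real \<alpha>\<^sub>2)"
    using ln_less \<gamma> assms(4) by (simp add: \<delta>_def ln_div)
  hence powr_\<delta>: "(\<gamma>\<^sub>1 / real \<alpha>\<^sub>2) powr \<delta> = real \<alpha>\<^sub>2"
    using \<gamma> assms(4) by (simp add: powr_def)
  have B_Suc: "B (Suc n) \<le> (\<beta>\<^sub>2 + \<alpha>\<^sub>2) * B n" for n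
    using B_Suc_le assms(7,8) by blast
  have "irrationality_exponent (gcf_value a b) (2 + \<delta>)"
    by (rule irrationality_exponent_of_geometric_decay[OF P_le B_Suc _ decay K ratio \<delta>_nonneg powr_\<delta>])
      (use assms(4) in simp)
  hence expo: "irrationality_exponent \<tau> (2 + \<delta>)"
    by (simp add: assms(11))
  have "convergent (gcf_convergent a b)"
    by (rule gcf_convergent_converges[OF quotient_tendsto_zero_of_geometric_decay[OF ratio decay]])
  moreover have "\<tau> \<notin> \<rat>"
    using expo by (rule irrationality_exponent_imp_irrational)
  moreover have "asymp_irrationality_exponent \<tau> \<le> ereal (2 + \<delta>)"
    unfolding asymp_irrationality_exponent_def using expo by (intro INF_lower) simp
  ultimately show ?thesis
    by (simp add: \<delta>_def)
qed

end
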